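(* Let $x = x_0 + x_1\mathbf{i}+x_2\mathbf{j}+x_3\mathbf{k}$ with $x_0,\dots,x_3\in\mathbb{R}[t]$, $x_0\neq 0$, be a reduced rational parametric equation of a rational curve of degree $d$ and circularity $c$. Then there is a unique (up to coordinate changes) rational motion of minimal degree, in the dual quaternion model of rigid body displacements, that has the curve parameterised by $x$ as trajectory, and its degree is $n = d - c$. Explicitly: the minimum of $\deg C$ over all polynomials $C$ parameterising a rational motion such that the trajectory of some point under $C$ is parameterised by $x$ is attained and equals $d-c$; and if $C$ and $C'$ both attain this minimum, then there exist $\lambda\in\mathbb{R}\setminus\{0\}$ and $h = p+\varepsilon q\in\mathbb{DH}$ with $p\ne 0$ and $p\overline{q}+q\overline{p}=0$ such that $C' = \lambda\, C h$.
   Context: $\mathbb{H}$ denotes the real quaternions with units $\mathbf{i},\mathbf{j},\mathbf{k}$, and $\mathbb{DH} = \mathbb{H} + \varepsilon\mathbb{H}$ the dual quaternions, where $\varepsilon^2=0$ and $\varepsilon$ commutes with everything. For $h = p + \varepsilon q$ with $p,q\in\mathbb{H}$, the conjugate is $\overline{h} = \overline{p} + \varepsilon \overline{q}$. In $\mathbb{DH}[t]$ and $\mathbb{H}[t]$ the indeterminate $t$ commutes with all coefficients, and conjugation of polynomials is done coefficientwise. Rigid body displacements correspond to points of the projective space over $\mathbb{DH}$ represented by $p+\varepsilon q$ with $p\overline q+q\overline p=0$ (Study quadric) and $p\neq 0$. A rational motion is parameterised by a polynomial $C=P+\varepsilon Q\in\mathbb{DH}[t]$ with $P,Q\in\mathbb{H}[t]$,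 $P\neq 0$ and $P\overline{Q}+Q\overline{P}=0$; its degree in the dual quaternion model is the degree of $C$ as a polynomial in $t$. Points of $\mathbb{P}^3$ are represented by non-zero $y = y_0 + y_1\mathbf{i}+y_2\mathbf{j}+y_3\mathbf{k}$ with $y_i\in\mathbb{R}$, up to real scalars. The trajectory of $y$ under $C$ is the rational curve $t\mapsto P y\overline{P} + 2y_0P\overline{Q}$; it is parameterised by $x$ if this polynomial expression agrees with $x$ up to multiplication with non-zero real polynomials. The coordinate changes meant are those of the moving frame: right multiplication of $C$ with a constant dual quaternion representing a rigid body displacement (a translation of the moving point and a choice of the orientation of the coordinate axes). The parametric equation $x$ is reduced if $\gcd(x_0,x_1,x_2,x_3)$ has degree zero. Its degree is $d = \max_i \deg x_i$, and its circularity is $c = \frac12\deg\gcd(x_0,x_1^2+x_2^2+x_3^2)$. *)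

theory Defs
  imports Complex_Main "HOL-Computational_Algebra.Polynomial_Factorial" "HOL-Computational_Algebra.Field_as_Ring"
begin

(* Quaternions over a commutative ring 'a.  The instance 'a = real is \<H>; the instance
   'a = real poly is \<H> \<otimes> \<real>[t] = \<H>[t] with an indeterminate commuting with all
   coefficients.  (The library's ring structure on 'c poly needs commutative 'c, so
   "real quat poly" carries no product.)  The lemmas on quat_coeff and dq_coeff below confirm
   the identification. *)

datatype 'a quat = Quat (q0: 'a) (q1: 'a) (q2: 'a) (q3: 'a)

instantiation quat :: (comm_ring_1) ring_1
begin

definition zero_quat :: "'a quat" where
  "0 = Quat 0 0 0 0"

definition one_quat :: "'a quat" where
  "1 = Quat 1 0 0 0"

definition plus_quat :: "'a quat \<Rightarrow> 'a quat \<Rightarrow> 'a quat" where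
  "x + y = Quat (q0 x + q0 y) (q1 x + q1 y) (q2 x + q2 y) (q3 x + q3 y)"

definition uminus_quat :: "'a quat \<Rightarrow> 'a quat" where
  "- x = Quat (- q0 x) (- q1 x) (- q2 x) (- q3 x)"

definition minus_quat :: "'a quat \<Rightarrow> 'a quat \<Rightarrow> 'a quat" where
  "x - y = Quat (q0 x - q0 y) (q1 x - q1 y) (q2 x - q2 y) (q3 x - q3 y)"

definition times_quat :: "'a quat \<Rightarrow> 'a quat \<Rightarrow> 'a quat" where
  "x * y = Quat
     (q0 x * q0 y - q1 x * q1 y - q2 x * q2 y - q3 x * q3 y)
     (q0 x * q1 y + q1 x * q0 y + q2 x * q3 y - q3 x * q2 y)
     (q0 x * q2 y - q1 x * q3 y + q2 x * q0 y + q3 x * q1 y)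
     (q0 x * q3 y + q1 x * q2 y - q2 x * q1 y + q3 x * q0 y)"

instance
  by standard
    (simp_all add: zero_quat_def one_quat_def plus_quat_def uminus_quat_def minus_quat_def
      times_quat_def algebra_simps quat.expand)

end

definition qcnj :: "'a::comm_ring_1 quat \<Rightarrow> 'a quat" where
  "qcnj x = Quat (q0 x) (- q1 x) (- q2 x) (- q3 x)"

(* Dual p q stands for p + \<epsilon> q. *)

datatype 'a dualnum = Dual (primal: 'a) (dual: 'a)

instantiation dualnum :: (ring_1) ring_1
begin

definition zero_dualnum :: "'a dualnum" where
  "0 = Dual 0 0"

definition one_dualnum :: "'a dualnum" where
  "1 = Dual 1 0"

definition plus_dualnum :: "'a dualnum \<Rightarrow> 'a dualnum \<Rightarrow> 'a dualnum" where
  "x + y = Dual (primal x + primal y) (dual x + dual y)"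

definition uminus_dualnum :: "'a dualnum \<Rightarrow> 'a dualnum" where
  "- x = Dual (- primal x) (- dual x)"

definition minus_dualnum :: "'a dualnum \<Rightarrow> 'a dualnum \<Rightarrow> 'a dualnum" where
  "x - y = Dual (primal x - primal y) (dual x - dual y)"

definition times_dualnum :: "'a dualnum \<Rightarrow> 'a dualnum \<Rightarrow> 'a dualnum" where
  "x * y = Dual (primal x * primal y) (primal x * dual y + dual x * primal y)"

instance
  by standard
    (simp_all add: zero_dualnum_def one_dualnum_def plus_dualnum_def uminus_dualnum_def
      minus_dualnum_def times_dualnum_def algebra_simps dualnum.expand)

end

type_synonym dual_quat = "real quat dualnum"
type_synonym dual_quat_poly = "real poly quat dualnum"

definition quat_const :: "real quat \<Rightarrow> real poly quat" where
  "quat_const = map_quat (\<lambda>a. [:a:])"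

definition dq_const :: "dual_quat \<Rightarrow> dual_quat_poly" where
  "dq_const = map_dualnum quat_const"

definition quat_scale :: "'a::comm_ring_1 \<Rightarrow> 'a quat \<Rightarrow> 'a quat" where
  "quat_scale a = map_quat ((*) a)"

definition dq_smult :: "real \<Rightarrow> dual_quat_poly \<Rightarrow> dual_quat_poly" where
  "dq_smult a = map_dualnum (map_quat (smult a))"

definition quat_degree :: "real poly quat \<Rightarrow> nat" where
  "quat_degree x = Max {degree (q0 x), degree (q1 x), degree (q2 x), degree (q3 x)}"

definition dq_degree :: "dual_quat_poly \<Rightarrow> nat" where
  "dq_degree C = max (quat_degree (primal C)) (quat_degree (dual C))"

definition quat_coeff :: "real poly quat \<Rightarrow> nat \<Rightarrow> real quat" where
  "quat_coeff x n = map_quat (\<lambda>p. coeff p n) x"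

definition dq_coeff :: "dual_quat_poly \<Rightarrow> nat \<Rightarrow> dual_quat" where
  "dq_coeff C n = map_dualnum (\<lambda>x. quat_coeff x n) C"

(* Non-zero primal part and Study condition.  For 'a = real: h represents a rigid body
   displacement; for 'a = real poly: C parameterises a rational motion. *)

definition displacement :: "'a::comm_ring_1 quat dualnum \<Rightarrow> bool" where
  "displacement h \<longleftrightarrow> primal h \<noteq> 0 \<and>
     primal h * qcnj (dual h) + dual h * qcnj (primal h) = 0"

abbreviation rational_motion :: "dual_quat_poly \<Rightarrow> bool" where
  "rational_motion C \<equiv> displacement C"

definition trajectory :: "dual_quat_poly \<Rightarrow> real quat \<Rightarrow> real poly quat" where
  "trajectory C y = primal C * quat_const y * qcnj (primal C)
     + quat_scale [:2 * q0 y:] (primal C * qcnj (dual C))"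

definition parameterised_by :: "real poly quat \<Rightarrow> real poly quat \<Rightarrow> bool" where
  "parameterised_by z x \<longleftrightarrow>
     (\<exists>f g. f \<noteq> 0 \<and> g \<noteq> 0 \<and> quat_scale f z = quat_scale g x)"

definition motion_with_trajectory :: "real poly quat \<Rightarrow> dual_quat_poly \<Rightarrow> bool" where
  "motion_with_trajectory x C \<longleftrightarrow>
     rational_motion C \<and> (\<exists>y. y \<noteq> 0 \<and> parameterised_by (trajectory C y) x)"

definition reduced :: "real poly quat \<Rightarrow> bool" where
  "reduced x \<longleftrightarrow> degree (gcd (q0 x) (gcd (q1 x) (gcd (q2 x) (q3 x)))) = 0"

definition circularity :: "real poly quat \<Rightarrow> real" where
  "circularity x = real (degree (gcd (q0 x) ((q1 x)^2 + (q2 x)^2 + (q3 x)^2))) / 2"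

lemma quat_sel_simps:
  "q0 (0 :: 'a::comm_ring_1 quat) = 0" "q1 (0 :: 'a quat) = 0"
  "q2 (0 :: 'a quat) = 0" "q3 (0 :: 'a quat) = 0"
  "q0 (x + y :: 'a quat) = q0 x + q0 y" "q1 (x + y) = q1 x + q1 y"
  "q2 (x + y) = q2 x + q2 y" "q3 (x + y) = q3 x + q3 y"
  by (simp_all add: zero_quat_def plus_quat_def)

lemma quat_sel_sum:
  fixes f :: "'b \<Rightarrow> 'a::comm_ring_1 quat"
  shows "q0 (sum f A) = (\<Sum>i\<in>A. q0 (f i))" "q1 (sum f A) = (\<Sum>i\<in>A. q1 (f i))"
    "q2 (sum f A) = (\<Sum>i\<in>A. q2 (f i))" "q3 (sum f A) = (\<Sum>i\<in>A. q3 (f i))"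
  by (induction A rule: infinite_finite_induct; simp add: quat_sel_simps)+

lemma dualnum_sel_sum:
  fixes f :: "'b \<Rightarrow> 'a::ring_1 dualnum"
  shows "primal (sum f A) = (\<Sum>i\<in>A. primal (f i))" "dual (sum f A) = (\<Sum>i\<in>A. dual (f i))"
  by (induction A rule: infinite_finite_induct; simp add: zero_dualnum_def plus_dualnum_def)+

lemma quat_coeff_mult:
  "quat_coeff (x * y) n = (\<Sum>i\<le>n. quat_coeff x i * quat_coeff y (n - i))"
  by (rule quat.expand)
    (simp add: quat_coeff_def quat.map_sel quat_sel_sum times_quat_def coeff_mult
      sum.distrib sum_subtractf)

lemma quat_coeff_add: "quat_coeff (x + y) n = quat_coeff x n + quat_coeff y n"
  by (simp add: quat_coeff_def quat.map_sel plus_quat_def)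

lemma dq_coeff_add: "dq_coeff (C + D) n = dq_coeff C n + dq_coeff D n"
  by (simp add: dq_coeff_def dualnum.map_sel plus_dualnum_def quat_coeff_add)

lemma dq_coeff_mult:
  "dq_coeff (C * D) n = (\<Sum>i\<le>n. dq_coeff C i * dq_coeff D (n - i))"
  by (rule dualnum.expand)
    (simp add: dq_coeff_def dualnum.map_sel dualnum_sel_sum times_dualnum_def quat_coeff_mult
      quat_coeff_add sum.distrib)

lemma quat_eq_iff: "x = y \<longleftrightarrow> q0 x = q0 y \<and> q1 x = q1 y \<and> q2 x = q2 y \<and> q3 x = q3 y"
  by (auto intro: quat.expand)

lemma dq_coeff_eq_iff: "C = D \<longleftrightarrow> (\<forall>n. dq_coeff C n = dq_coeff D n)"
  by (cases C; cases D)
    (auto simp: dq_coeff_def quat_coeff_def quat_eq_iff quat.map_sel poly_eq_iff)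

lemma quat_degree_le_iff: "quat_degree x \<le> n \<longleftrightarrow> (\<forall>m>n. quat_coeff x m = 0)"
proof -
  have *: "degree p \<le> n \<longleftrightarrow> (\<forall>m>n. coeff p m = 0)" for p :: "real poly"
    by (meson coeff_eq_0 degree_le le_less_trans)
  show ?thesis
    by (auto simp: quat_degree_def quat_coeff_def quat_eq_iff quat.map_sel quat_sel_simps *)
qed

lemma dq_degree_le_iff: "dq_degree C \<le> n \<longleftrightarrow> (\<forall>m>n. dq_coeff C m = 0)"
  by (cases C) (auto simp: dq_degree_def quat_degree_le_iff dq_coeff_def zero_dualnum_def)

lemma dq_coeff_const: "dq_coeff (dq_const h) n = (if n = 0 then h else 0)"
  by (cases h)
    (auto simp: dq_coeff_def dq_const_def quat_const_def quat_coeff_def quat_eq_iff quat.map_sel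
      zero_dualnum_def quat_sel_simps coeff_pCons split: nat.splits)

end

theory Submission
  imports Defs
begin

text \<open>
  A translation of the moving frame carries the point \<open>y\<close> to the origin, so let \<open>y = 1\<close>. Split
  \<open>x = x\<^sub>0 + v\<close> into its scalar and its vector part, and write \<open>P\<^sup>*\<close> for the conjugate of \<open>P\<close>.
  By the Study condition \<open>P Q\<^sup>*\<close> is a pure vector, and since \<open>x\<close> is reduced, \<open>P + \<epsilon> Q\<close> moves the
  origin along \<open>x\<close> exactly if \<open>|P|\<^sup>2 = h x\<^sub>0\<close> and \<open>2 P Q\<^sup>* = h v\<close> for some real polynomial
  \<open>h \<noteq> 0\<close> (\<open>origin_motion_iff\<close>).

  Let \<open>G = gcd x\<^sub>0 |v|\<^sup>2\<close>, of degree \<open>2 c\<close>, and \<open>x\<^sub>0 = a G\<close>, \<open>|v|\<^sup>2 = b G\<close>. Taking norms in the second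
  equation gives \<open>4 a |Q|\<^sup>2 = h b\<close>, and as \<open>a\<close>, \<open>b\<close> are coprime, \<open>h = k a\<close>. Hence
  \<open>|P|\<^sup>2 = k a\<^sup>2 G\<close> and \<open>4 |Q|\<^sup>2 = k b\<close>. Norms double degrees, so the motion has degree
  \<open>d - c + deg k / 2\<close> (\<open>origin_motion_degree\<close>), and the minimal motions are those with \<open>k\<close> constant,
  provided that there are any.

  To find one, take for \<open>D\<close> a greatest common left divisor of \<open>v\<close> and \<open>G\<close> in the ring of quaternion
  polynomials, which admits division with remainder. Because \<open>x\<close> is reduced, no non-constant real
  polynomial divides both \<open>v\<close> and \<open>G\<close>, and this forces \<open>|D|\<^sup>2\<close> to be a constant multiple of \<open>G\<close>
  (\<open>exists_left_factor\<close>). If \<open>v = D V\<close>, then \<open>P = a D\<close> with \<open>Q\<^sup>*\<close> a constant multiple of \<open>V\<close>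
  is a motion with constant \<open>k\<close>.

  Conversely let \<open>k\<close> be constant. Multiplying \<open>2 P Q\<^sup>* = k a v\<close> by \<open>2 Q\<close> from the right yields
  \<open>b P = 2 a v Q\<close>, so \<open>a\<close> divides \<open>P\<close>, and \<open>A = P / a\<close> is a left factor of \<open>v\<close> whose norm is a constant
  multiple of \<open>G\<close>. Such a factor generates the right ideal spanned by \<open>v\<close> and \<open>G\<close>, so it is unique
  up to a constant quaternion on the right (\<open>left_factor_unique\<close>). That quaternion is the rotation
  relating two minimal motions; together with the two translations it is the change of the moving
  frame.
\<close>

section \<open>Quaternions over an ordered domain\<close>

definition scalar :: "'a::comm_ring_1 \<Rightarrow> 'a quat" where
  "scalar a = Quat a 0 0 0"

definition qnorm :: "'a::comm_ring_1 quat \<Rightarrow> 'a" where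
  "qnorm x = q0 x ^ 2 + q1 x ^ 2 + q2 x ^ 2 + q3 x ^ 2"

lemmas quat_components = quat_eq_iff times_quat_def plus_quat_def minus_quat_def uminus_quat_def
  zero_quat_def one_quat_def scalar_def qcnj_def qnorm_def

lemma scalar_commute: "x * scalar a = scalar a * x"
  by (simp add: quat_components algebra_simps)

lemma scalar_left_commute: "x * (scalar a * y) = scalar a * (x * y)"
  by (simp add: quat_components algebra_simps)

lemma scalar_mult: "scalar (a * b) = scalar a * scalar b"
  and scalar_one: "scalar 1 = 1"
  and scalar_zero: "scalar 0 = 0"
  and qcnj_scalar: "qcnj (scalar a) = scalar a"
  by (simp_all add: quat_components)

lemma quat_scale_eq: "quat_scale a x = scalar a * x"
  by (cases x) (simp add: quat_scale_def quat_components quat.map_sel)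

lemma qcnj_mult: "qcnj (x * y) = qcnj y * qcnj x"
  by (simp add: quat_components algebra_simps)

lemma qcnj_add: "qcnj (x + y) = qcnj x + qcnj y"
  and qcnj_qcnj: "qcnj (qcnj x) = x"
  by (simp_all add: quat_components)

lemma mult_qcnj: "x * qcnj x = scalar (qnorm x)"
  and qcnj_mult_self: "qcnj x * x = scalar (qnorm x)"
  by (simp_all add: quat_components power2_eq_square algebra_simps)

lemma qnorm_mult: "qnorm (x * y) = qnorm x * qnorm y"
  by (simp add: quat_components power2_eq_square algebra_simps)

lemma qnorm_qcnj: "qnorm (qcnj x) = qnorm x"
  and qnorm_scalar: "qnorm (scalar a) = a ^ 2"
  by (simp_all add: quat_components)

lemma qnorm_eq_0_iff: "qnorm x = 0 \<longleftrightarrow> x = 0" for x :: "'a::linordered_idom quat"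
proof
  assume "qnorm x = 0"
  moreover have "0 \<le> q0 x ^ 2" "0 \<le> q1 x ^ 2" "0 \<le> q2 x ^ 2" "0 \<le> q3 x ^ 2"
    by simp_all
  ultimately have "q0 x ^ 2 = 0" "q1 x ^ 2 = 0" "q2 x ^ 2 = 0" "q3 x ^ 2 = 0"
    unfolding qnorm_def by linarith+
  then show "x = 0"
    by (simp add: quat_components)
qed (simp add: quat_components)

lemma quat_mult_eq_0_iff: "x * y = 0 \<longleftrightarrow> x = 0 \<or> y = 0" for x y :: "'a::linordered_idom quat"
  by (metis qnorm_eq_0_iff qnorm_mult mult_eq_0_iff)

lemma quat_mult_left_cancel: "x \<noteq> 0 \<Longrightarrow> x * y = x * z \<longleftrightarrow> y = z"
  for x y z :: "'a::linordered_idom quat"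
  using quat_mult_eq_0_iff[of x "y - z"] by (simp add: right_diff_distrib)

lemma scalar_eq_0_iff: "scalar a = 0 \<longleftrightarrow> a = 0"
  by (simp add: quat_components)

definition scalar_dvd :: "'a::comm_ring_1 \<Rightarrow> 'a quat \<Rightarrow> bool" where
  "scalar_dvd m x \<longleftrightarrow> (\<exists>z. x = scalar m * z)"

lemma scalar_dvd_iff:
  "scalar_dvd m x \<longleftrightarrow> m dvd q0 x \<and> m dvd q1 x \<and> m dvd q2 x \<and> m dvd q3 x"
proof
  assume "m dvd q0 x \<and> m dvd q1 x \<and> m dvd q2 x \<and> m dvd q3 x"
  then obtain a b c d where "q0 x = m * a" "q1 x = m * b" "q2 x = m * c" "q3 x = m * d"
    unfolding dvd_def by blast
  then have "x = scalar m * Quat a b c d"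
    by (simp add: quat_components)
  then show "scalar_dvd m x"
    unfolding scalar_dvd_def ..
next
  assume "scalar_dvd m x"
  then show "m dvd q0 x \<and> m dvd q1 x \<and> m dvd q2 x \<and> m dvd q3 x"
    by (auto simp add: scalar_dvd_def quat_components)
qed

lemma scalar_dvd_scalar: "scalar_dvd m (scalar a) \<longleftrightarrow> m dvd a"
  by (simp add: scalar_dvd_iff) (simp add: scalar_def)

text \<open>The expression in the Study condition is a quaternion plus its conjugate, that is, twice its
  scalar part. So the condition says that \<open>p q\<^sup>*\<close> is a pure vector.\<close>

lemma displacement_iff: "displacement h \<longleftrightarrow> primal h \<noteq> 0 \<and> q0 (primal h * qcnj (dual h)) = 0"
  for h :: "'a::linordered_idom quat dualnum"
proof -
  have "p * qcnj q + q * qcnj p = scalar (2 * q0 (p * qcnj q))" for p q :: "'a quat"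
    by (simp add: quat_components algebra_simps)
  then show ?thesis
    by (simp add: displacement_def scalar_eq_0_iff)
qed

text \<open>The Study expression of a product \<open>g h\<close> is the one of \<open>h\<close>, conjugated by the primal part of \<open>g\<close>,
  plus the one of \<open>g\<close>, scaled by the norm of the primal part of \<open>h\<close>.\<close>

lemma displacement_mult:
  fixes g h :: "'a::linordered_idom quat dualnum"
  assumes "displacement g" "displacement h"
  shows "displacement (g * h)"
proof -
  have "primal (g * h) * qcnj (dual (g * h)) + dual (g * h) * qcnj (primal (g * h))
      = primal g * (primal h * qcnj (dual h) + dual h * qcnj (primal h)) * qcnj (primal g)
        + primal g * (primal h * qcnj (primal h)) * qcnj (dual g)
        + dual g * (primal h * qcnj (primal h)) * qcnj (primal g)"
    by (simp add: times_dualnum_def qcnj_mult qcnj_add algebra_simps)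
  also have "\<dots> = scalar (qnorm (primal h))
      * (primal g * qcnj (dual g) + dual g * qcnj (primal g))"
    using assms(2) by (simp add: displacement_def mult_qcnj scalar_left_commute mult.assoc
        distrib_left)
  finally show ?thesis
    using assms by (simp add: displacement_def times_dualnum_def quat_mult_eq_0_iff)
qed

section \<open>Division in the ring of quaternion polynomials\<close>

lemma coeff_square_top:
  fixes p :: "real poly"
  assumes "degree p \<le> n"
  shows "coeff (p ^ 2) (2 * n) = coeff p n ^ 2"
proof (cases "degree p = n")
  case True
  then show ?thesis
    using coeff_mult_degree_sum[of p p] by (simp add: power2_eq_square mult_2)
next
  case False
  then have "degree p < n"
    using assms by simp
  moreover from this have "degree (p ^ 2) < 2 * n"
    by (metis degree_power_le le_less_trans mult.commute mult_less_mono2 zero_less_numeral)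
  ultimately show ?thesis
    by (simp add: coeff_eq_0)
qed

lemma degree_le_quat_degree:
  "degree (q0 x) \<le> quat_degree x" "degree (q1 x) \<le> quat_degree x"
  "degree (q2 x) \<le> quat_degree x" "degree (q3 x) \<le> quat_degree x"
  by (simp_all add: quat_degree_def)

text \<open>The squares of the top coefficients cannot cancel because they are real.\<close>

lemma degree_qnorm: "degree (qnorm x) = 2 * quat_degree x"
proof (rule antisym)
  have "degree (p ^ 2) \<le> 2 * quat_degree x" if "degree p \<le> quat_degree x" for p :: "real poly"
    using degree_power_le[of p 2] that by simp
  then show "degree (qnorm x) \<le> 2 * quat_degree x"
    unfolding qnorm_def by (intro degree_add_le) (simp_all add: degree_le_quat_degree)
  show "2 * quat_degree x \<le> degree (qnorm x)"
  proof (cases "quat_degree x = 0")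
    case False
    define n where "n = quat_degree x"
    have "n \<in> {degree (q0 x), degree (q1 x), degree (q2 x), degree (q3 x)}"
      unfolding n_def quat_degree_def by (rule Max_in) simp_all
    then have "coeff (q0 x) n \<noteq> 0 \<or> coeff (q1 x) n \<noteq> 0 \<or> coeff (q2 x) n \<noteq> 0 \<or> coeff (q3 x) n \<noteq> 0"
      using False by (auto simp: n_def)
    then have "coeff (q0 x) n ^ 2 + coeff (q1 x) n ^ 2 + coeff (q2 x) n ^ 2 + coeff (q3 x) n ^ 2 \<noteq> 0"
      by (simp add: add_nonneg_eq_0_iff)
    then have "coeff (qnorm x) (2 * n) \<noteq> 0"
      using degree_le_quat_degree[of x] by (simp add: qnorm_def coeff_square_top n_def)
    then show ?thesis
      by (simp add: n_def le_degree)
  qed simp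
qed

text \<open>Division by \<open>Y\<close> reduces to division by the real polynomial \<open>|Y|\<^sup>2\<close>: divide \<open>Y\<^sup>* X\<close> by it in
  each component. The remainder of this division is \<open>Y\<^sup>* R\<close>, and its degree is less than twice
  that of \<open>Y\<close>, so \<open>R\<close> has a smaller degree than \<open>Y\<close>.\<close>

lemma quat_division:
  assumes "Y \<noteq> 0"
  shows "\<exists>K R. X = Y * K + R \<and> (R = 0 \<or> quat_degree R < quat_degree Y)"
proof -
  define N where "N = qnorm Y"
  define Z where "Z = qcnj Y * X"
  define K where "K = Quat (q0 Z div N) (q1 Z div N) (q2 Z div N) (q3 Z div N)"
  define S where "S = Quat (q0 Z mod N) (q1 Z mod N) (q2 Z mod N) (q3 Z mod N)"
  define R where "R = X - Y * K"
  have "N \<noteq> 0"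
    using assms by (simp add: N_def qnorm_eq_0_iff)
  have "Z = scalar N * K + S"
    by (simp add: K_def S_def quat_components)
  then have S_eq: "S = qcnj Y * R"
    by (simp add: R_def Z_def right_diff_distrib N_def flip: qcnj_mult_self mult.assoc)
  have "quat_degree R < quat_degree Y" if "R \<noteq> 0"
  proof -
    have "S \<noteq> 0"
      using that \<open>N \<noteq> 0\<close> by (metis S_eq N_def quat_mult_eq_0_iff qnorm_eq_0_iff qnorm_qcnj)
    have deg: "p mod N = 0 \<or> degree (p mod N) < degree N" for p
      using \<open>N \<noteq> 0\<close> by (rule degree_mod_less)
    have "0 < degree N"
    proof (rule ccontr)
      assume "\<not> 0 < degree N"
      then have "p mod N = 0" for p
        using deg[of p] by simp
      then show False
        using \<open>S \<noteq> 0\<close> by (simp add: S_def zero_quat_def)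
    qed
    then have "degree (p mod N) < degree N" for p
      using deg[of p] by auto
    then have "quat_degree S < degree N"
      by (simp add: quat_degree_def S_def)
    moreover have "2 * quat_degree S = 2 * quat_degree Y + 2 * quat_degree R"
      using assms that unfolding S_eq degree_qnorm[symmetric] qnorm_mult qnorm_qcnj
      by (intro degree_mult_eq) (simp_all add: qnorm_eq_0_iff)
    ultimately show ?thesis
      by (simp add: N_def degree_qnorm)
  qed
  moreover have "X = Y * K + R"
    by (simp add: R_def)
  ultimately show ?thesis
    by blast
qed

text \<open>As in a commutative Euclidean ring, a non-zero element of least degree generates the right ideal
  spanned by \<open>X\<close> and \<open>Y\<close>.\<close>

lemma left_bezout:
  assumes "X \<noteq> 0 \<or> Y \<noteq> 0"
  obtains D \<alpha> \<beta> X' Y' where "D = X * \<alpha> + Y * \<beta>" "X = D * X'" "Y = D * Y'" "D \<noteq> (0::real poly quat)"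
proof -
  define I where "I = {Z. Z \<noteq> 0 \<and> (\<exists>\<alpha> \<beta>. Z = X * \<alpha> + Y * \<beta>)}"
  have "X = X * 1 + Y * 0" "Y = X * 0 + Y * 1"
    by simp_all
  then have "\<exists>Z. Z \<in> I"
    using assms unfolding I_def by blast
  then obtain D where D: "D \<in> I" and min: "\<And>Z. Z \<in> I \<Longrightarrow> quat_degree D \<le> quat_degree Z"
    using ex_has_least_nat[of "\<lambda>Z. Z \<in> I" _ quat_degree] by blast
  from D obtain \<alpha> \<beta> where comb: "D = X * \<alpha> + Y * \<beta>" and "D \<noteq> 0"
    by (auto simp: I_def)
  have generated: "\<exists>K. X * \<gamma> + Y * \<delta> = D * K" for \<gamma> \<delta>
  proof -
    obtain K R where KR: "X * \<gamma> + Y * \<delta> = D * K + R" "R = 0 \<or> quat_degree R < quat_degree D"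
      using quat_division[OF \<open>D \<noteq> 0\<close>] by blast
    have "R = X * \<gamma> + Y * \<delta> - D * K"
      by (simp add: KR(1))
    also have "\<dots> = X * (\<gamma> - \<alpha> * K) + Y * (\<delta> - \<beta> * K)"
      unfolding comb by (simp add: algebra_simps)
    finally have "R = 0 \<or> R \<in> I"
      unfolding I_def by blast
    then have "R = 0"
      using KR(2) min[of R] by auto
    then show ?thesis
      using KR by auto
  qed
  obtain X' Y' where "X = D * X'" "Y = D * Y'"
    using generated[of 1 0] generated[of 0 1] by auto
  then show thesis
    using that comb \<open>D \<noteq> 0\<close> by blast
qed

lemma quat_degree_0_const:
  assumes "quat_degree X = 0"
  obtains u where "X = quat_const u"
proof -
  have "degree (q0 X) = 0" "degree (q1 X) = 0" "degree (q2 X) = 0" "degree (q3 X) = 0"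
    using degree_le_quat_degree[of X] assms by simp_all
  then obtain a b c d where "q0 X = [:a:]" "q1 X = [:b:]" "q2 X = [:c:]" "q3 X = [:d:]"
    by (metis degree_eq_zeroE)
  then have "X = quat_const (Quat a b c d)"
    by (simp add: quat_const_def quat_eq_iff)
  then show thesis ..
qed

section \<open>Left factors of prescribed norm\<close>

text \<open>Primitivity of \<open>v\<close> is required at the real divisors of \<open>G\<close> only: the vector part of a reduced
  curve may have a real factor, but it shares none with \<open>x\<^sub>0\<close>.\<close>

definition primitive_at :: "real poly \<Rightarrow> real poly quat \<Rightarrow> bool" where
  "primitive_at G v \<longleftrightarrow> (\<forall>m. m dvd G \<longrightarrow> scalar_dvd m v \<longrightarrow> degree m = 0)"

text \<open>Let \<open>D = v \<alpha> + G \<beta>\<close> be a greatest common left divisor of \<open>v\<close> and \<open>G\<close>. Expanding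
  \<open>|D|\<^sup>2 = D D\<^sup>*\<close>, every term contains the factor \<open>G\<close> or \<open>|v|\<^sup>2\<close>, so \<open>|D|\<^sup>2 = m G\<close>. With
  \<open>G = D H\<close> it follows that \<open>D = m H\<^sup>*\<close>. So the real polynomial \<open>m\<close> divides \<open>D\<close>, and with it
  both \<open>v\<close> and \<open>G\<close>; by primitivity it is constant.\<close>

lemma exists_left_factor:
  assumes "G \<noteq> 0" "G dvd qnorm v" "primitive_at G v"
  obtains D V m where "v = D * V" "qnorm D = m * G" "degree m = 0" "m \<noteq> 0"
proof -
  have "scalar G \<noteq> 0"
    using assms by (simp add: scalar_eq_0_iff)
  then obtain D \<alpha> \<beta> V H where D: "D = v * \<alpha> + scalar G * \<beta>" "v = D * V" "scalar G = D * H" "D \<noteq> 0"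
    using left_bezout[of v "scalar G"] by metis
  have "scalar_dvd G (scalar (qnorm D))"
  proof -
    obtain N where "qnorm v = G * N"
      using assms(2) ..
    then have "v * qcnj v = scalar G * scalar N"
      by (simp add: mult_qcnj scalar_mult)
    then have vv: "v * (qcnj v * Z) = scalar G * (scalar N * Z)" for Z
      by (metis mult.assoc)
    have "scalar (qnorm D) = D * qcnj D"
      by (simp add: mult_qcnj)
    also have "\<dots> = v * (scalar (qnorm \<alpha>) * qcnj v)
        + scalar G * (v * \<alpha> * qcnj \<beta> + \<beta> * qcnj \<alpha> * qcnj v + scalar G * \<beta> * qcnj \<beta>)"
      unfolding mult_qcnj[symmetric] D(1) qcnj_add qcnj_mult qcnj_scalar
      by (simp add: distrib_left distrib_right mult.assoc scalar_commute[of "qcnj \<beta>"]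
          scalar_left_commute[of v] scalar_left_commute[of \<alpha>] scalar_left_commute[of \<beta>])
    also have "v * (scalar (qnorm \<alpha>) * qcnj v) = scalar G * (scalar N * scalar (qnorm \<alpha>))"
      by (simp add: scalar_commute[of "qcnj v", symmetric] vv)
    finally show ?thesis
      unfolding scalar_dvd_def by (metis distrib_left)
  qed
  then have "G dvd qnorm D"
    by (simp add: scalar_dvd_scalar)
  then obtain m where m: "qnorm D = G * m" ..
  have "scalar G * qcnj D = scalar G * (scalar m * H)"
  proof -
    have "scalar G * qcnj D = qcnj D * D * H"
      by (metis D(3) mult.assoc scalar_commute)
    then show ?thesis
      by (simp add: qcnj_mult_self m scalar_mult mult.assoc)
  qed
  then have "qcnj D = scalar m * H"
    using \<open>scalar G \<noteq> 0\<close> by (simp add: quat_mult_left_cancel)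
  then have Dm: "D = scalar m * qcnj H"
    by (metis qcnj_qcnj qcnj_mult qcnj_scalar scalar_commute)
  have "scalar_dvd m v" "scalar_dvd m (scalar G)"
    using D(2,3) Dm unfolding scalar_dvd_def by (metis mult.assoc)+
  then have "degree m = 0"
    using assms(3) by (simp add: primitive_at_def scalar_dvd_scalar)
  moreover have "m \<noteq> 0"
    using m D(4) by (auto simp: qnorm_eq_0_iff)
  ultimately show thesis
    using that[OF D(2), of m] m by (simp add: mult.commute)
qed

text \<open>A greatest common left divisor \<open>E\<close> of \<open>B\<close> and \<open>A\<^sup>*\<close> is a unit: \<open>E\<^sup>*\<close> is a right divisor of \<open>A\<close>, so
  \<open>|E|\<^sup>2 = E\<^sup>* E\<close> divides \<open>v = A B\<close>, and it divides \<open>|A|\<^sup>2\<close> as well. Multiplying a Bezout identity for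
  \<open>E\<close> by \<open>A\<close> from the left expresses \<open>A E\<close> through \<open>A B = v\<close> and \<open>A A\<^sup>* = k G\<close>.\<close>

lemma left_factor_in_ideal:
  assumes "v = A * B" "qnorm A = k * G" "degree k = 0" "A \<noteq> 0" "primitive_at G v"
  obtains \<alpha> \<beta> where "A = v * \<alpha> + scalar G * \<beta>"
proof -
  have "qcnj A \<noteq> 0"
    using assms(4) by (metis qcnj_qcnj qnorm_eq_0_iff qnorm_qcnj)
  then obtain E \<alpha> \<beta> S F where E: "E = B * \<alpha> + qcnj A * \<beta>" "B = E * S" "qcnj A = E * F" "E \<noteq> 0"
    using left_bezout[of B "qcnj A"] by metis
  have A: "A = qcnj F * qcnj E"
    using E(3) by (metis qcnj_mult qcnj_qcnj)
  have "v = qcnj F * (qcnj E * E) * S"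
    by (simp add: assms(1) A E(2) mult.assoc)
  then have "scalar_dvd (qnorm E) v"
    by (auto simp: scalar_dvd_def qcnj_mult_self scalar_left_commute mult.assoc)
  moreover have "k \<noteq> 0"
    using assms(2,4) by (auto simp: qnorm_eq_0_iff)
  have "qnorm E dvd k * G"
    using arg_cong[OF A, of qnorm] by (simp add: qnorm_mult qnorm_qcnj flip: assms(2))
  then have "qnorm E dvd G"
    using \<open>k \<noteq> 0\<close> assms(3) by (metis dvd_mult_unit_iff' is_unit_iff_degree)
  ultimately have "degree (qnorm E) = 0"
    using assms(5) by (simp add: primitive_at_def)
  then have "qnorm E dvd 1"
    using E(4) by (simp add: is_unit_iff_degree qnorm_eq_0_iff)
  then obtain e where e: "1 = qnorm E * e" ..
  have "A = A * (E * qcnj E) * scalar e"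
    by (simp add: mult_qcnj mult.assoc e[symmetric] scalar_one flip: scalar_mult)
  also have "A * (E * qcnj E) * scalar e = (A * E) * (qcnj E * scalar e)"
    by (simp add: mult.assoc)
  also have "A * E = v * \<alpha> + scalar G * (scalar k * \<beta>)"
    unfolding E(1) distrib_left mult.assoc[symmetric] mult_qcnj assms(1,2)
    by (simp add: mult.commute[of k G] scalar_mult)
  finally have "A = v * (\<alpha> * (qcnj E * scalar e)) + scalar G * (scalar k * \<beta> * (qcnj E * scalar e))"
    by (simp add: distrib_right mult.assoc)
  then show thesis ..
qed

text \<open>Since \<open>v\<close> and \<open>G\<close> are right multiples of \<open>A\<close>, so is every element of the right ideal that they
  span, in particular \<open>A' = A U\<close>. Comparison of norms shows that \<open>U\<close> has degree zero.\<close>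

lemma left_factor_unique:
  assumes "primitive_at G v"
    and "v = A * B" "qnorm A = k * G" "degree k = 0" "A \<noteq> 0"
    and "v = A' * B'" "qnorm A' = k' * G" "degree k' = 0" "A' \<noteq> 0"
  obtains u where "A' = A * quat_const u"
proof -
  have "k \<noteq> 0" "G \<noteq> 0" "k' \<noteq> 0"
    using assms(3,5,7,9) by (auto simp: qnorm_eq_0_iff)
  then have "k dvd 1"
    using assms(4) by (simp add: is_unit_iff_degree)
  then obtain j where j: "1 = k * j" ..
  obtain \<alpha> \<beta> where \<alpha>\<beta>: "A' = v * \<alpha> + scalar G * \<beta>"
    using left_factor_in_ideal[OF assms(6-9,1)] .
  have "scalar G = scalar (k * G * j)"
    using j by (metis mult.assoc mult.commute mult_1)
  also have "\<dots> = A * (qcnj A * scalar j)"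
    by (simp add: scalar_mult assms(3)[symmetric] mult_qcnj[symmetric] mult.assoc)
  finally have "A' = A * (B * \<alpha> + qcnj A * scalar j * \<beta>)"
    unfolding \<alpha>\<beta> assms(2) by (simp add: distrib_left mult.assoc)
  then obtain U where U: "A' = A * U"
    by blast
  have "k' * G = k * qnorm U * G"
    using arg_cong[OF U, of qnorm] assms(3,7) by (simp add: qnorm_mult ac_simps)
  then have "k' = k * qnorm U"
    using \<open>G \<noteq> 0\<close> by simp
  then have "degree k' = degree k + degree (qnorm U)"
    using \<open>k' \<noteq> 0\<close> by (auto intro!: degree_mult_eq)
  then have "quat_degree U = 0"
    using assms(8) by (simp add: degree_qnorm)
  then obtain u where "U = quat_const u"
    by (rule quat_degree_0_const)
  then show thesis
    using that U by blast
qed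

section \<open>Rigid motions and changes of the moving frame\<close>

lemma quat_const_mult: "quat_const (u * w) = quat_const u * quat_const w"
  by (simp add: quat_const_def quat_components quat.map_sel)

lemma quat_const_qcnj: "quat_const (qcnj u) = qcnj (quat_const u)"
  and quat_const_one: "quat_const 1 = 1"
  by (simp_all add: quat_const_def quat_components quat.map_sel one_pCons)

lemma quat_const_eq_0_iff: "quat_const u = 0 \<longleftrightarrow> u = 0"
  by (simp add: quat_const_def quat_components quat.map_sel)

lemma dq_const_sel: "primal (dq_const h) = quat_const (primal h)"
  "dual (dq_const h) = quat_const (dual h)"
  by (simp_all add: dq_const_def dualnum.map_sel)

lemma displacement_dq_const:
  assumes "displacement h"
  shows "displacement (dq_const h)"
proof -
  have "q0 (quat_const (primal h * qcnj (dual h))) = 0"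
    using assms by (simp add: displacement_iff quat_const_def quat.map_sel)
  then show ?thesis
    using assms by (simp add: displacement_iff dq_const_sel quat_const_eq_0_iff quat_const_mult
        quat_const_qcnj)
qed

lemma dq_coeff_mult_const: "dq_coeff (C * dq_const h) n = dq_coeff C n * h"
proof -
  have "dq_coeff (C * dq_const h) n = (\<Sum>i\<le>n. if i = n then dq_coeff C i * h else 0)"
    unfolding dq_coeff_mult dq_coeff_const by (rule sum.cong) auto
  then show ?thesis
    by simp
qed

lemma mult_dq_const_assoc: "C * dq_const g * dq_const h = C * dq_const (g * h)"
  unfolding dq_coeff_eq_iff dq_coeff_mult_const by (simp add: mult.assoc)

lemma mult_dq_const_one: "C * dq_const 1 = C"
  by (simp add: dq_coeff_eq_iff dq_coeff_mult_const)

lemma dq_degree_mult_const_le: "dq_degree (C * dq_const h) \<le> dq_degree C"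
  unfolding dq_degree_le_iff dq_coeff_mult_const
  using dq_degree_le_iff[of C "dq_degree C"] by simp

abbreviation translation :: "real quat \<Rightarrow> dual_quat" where
  "translation r \<equiv> Dual 1 r"

lemma displacement_translation: "q0 r = 0 \<Longrightarrow> displacement (translation r)"
  by (simp add: displacement_iff) (simp add: quat_components)

lemma translation_inverse: "translation r * translation (- r) = 1"
  by (simp add: times_dualnum_def one_dualnum_def)

lemma undo_translation: "C * dq_const (translation r) * dq_const (translation (- r)) = C"
  by (simp add: mult_dq_const_assoc translation_inverse mult_dq_const_one)

text \<open>A right multiplication does not raise the degree, and neither does the inverse one.\<close>

lemma dq_degree_translation: "dq_degree (C * dq_const (translation r)) = dq_degree C"
  using dq_degree_mult_const_le[of C "translation r"]
    dq_degree_mult_const_le[of "C * dq_const (translation r)" "translation (- r)"]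
  by (simp add: undo_translation)

definition origin_motion :: "real poly quat \<Rightarrow> dual_quat_poly \<Rightarrow> bool" where
  "origin_motion x C \<longleftrightarrow> rational_motion C \<and> parameterised_by (trajectory C 1) x"

lemma origin_motion_imp_motion: "origin_motion x C \<Longrightarrow> motion_with_trajectory x C"
  unfolding origin_motion_def motion_with_trajectory_def by (metis zero_neq_one)

lemma trajectory_eq: "trajectory C y
    = primal C * (quat_const y * qcnj (primal C)) + scalar [:2 * q0 y:] * (primal C * qcnj (dual C))"
  by (simp add: trajectory_def quat_scale_eq mult.assoc)

lemma trajectory_origin:
  "trajectory C 1 = scalar (qnorm (primal C)) + scalar 2 * (primal C * qcnj (dual C))"
  by (simp add: trajectory_eq quat_const_one mult_qcnj numeral_poly) (simp add: one_quat_def)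

definition shift_to_origin :: "real quat \<Rightarrow> real quat" where
  "shift_to_origin y = Quat 0 (- q1 y / (2 * q0 y)) (- q2 y / (2 * q0 y)) (- q3 y / (2 * q0 y))"

text \<open>The vector \<open>r = shift_to_origin y\<close> is \<open>- y\<^sub>v / (2 y\<^sub>0)\<close> with \<open>y\<^sub>v\<close> the vector part of \<open>y\<close>. It solves
  \<open>y = y\<^sub>0 + 2 y\<^sub>0 r\<^sup>*\<close>, which makes the contribution \<open>2 P (P r)\<^sup>* = 2 P r\<^sup>* P\<^sup>*\<close> of the translation to the
  trajectory of the origin equal to \<open>P y\<^sub>v P\<^sup>* / y\<^sub>0\<close>.\<close>

lemma trajectory_translation:
  assumes "q0 y \<noteq> 0"
  shows "scalar [:q0 y:] * trajectory (C * dq_const (translation (shift_to_origin y))) 1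
    = trajectory C y"
proof -
  define r where "r = shift_to_origin y"
  define P Q where "P = primal C" and "Q = dual C"
  have y: "quat_const y = scalar [:q0 y:] + scalar [:2 * q0 y:] * qcnj (quat_const r)"
    using assms by (simp add: quat_components quat_const_def quat.map_sel r_def
        shift_to_origin_def)
  have two: "scalar [:q0 y:] * (scalar 2 * Z) = scalar [:2 * q0 y:] * Z" for Z
    by (simp add: numeral_poly flip: mult.assoc scalar_mult)
  have "scalar [:q0 y:] * trajectory (C * dq_const (translation r)) 1
      = scalar [:q0 y:] * (P * qcnj P) + scalar [:2 * q0 y:] * (P * qcnj (Q + P * quat_const r))"
    by (simp add: trajectory_origin times_dualnum_def dq_const_sel quat_const_one distrib_left
        two mult_qcnj add.commute flip: P_def Q_def)
  also have "\<dots> = trajectory C y"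
    by (simp add: trajectory_eq y distrib_left distrib_right qcnj_add qcnj_mult mult.assoc
        scalar_left_commute flip: P_def Q_def)
  finally show ?thesis
    by (simp add: r_def)
qed

text \<open>The point \<open>y\<close> is finite, because the trajectory of a point at infinity stays in the plane at
  infinity while \<open>x\<^sub>0 \<noteq> 0\<close>.\<close>

lemma translate_to_origin:
  assumes "q0 x \<noteq> 0" "motion_with_trajectory x C"
  obtains r where "q0 r = 0" "origin_motion x (C * dq_const (translation r))"
proof -
  obtain y f g where C: "rational_motion C"
    and fg: "f \<noteq> 0" "g \<noteq> 0" "quat_scale f (trajectory C y) = quat_scale g x"
    using assms(2) by (auto simp: motion_with_trajectory_def parameterised_by_def)
  have "q0 y \<noteq> 0"
  proof
    assume "q0 y = 0"
    have "q0 (P * (quat_const y * qcnj P)) = 0" for P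
      using \<open>q0 y = 0\<close> by (simp add: quat_const_def quat_components quat.map_sel algebra_simps)
    then have "q0 (trajectory C y) = 0"
      using \<open>q0 y = 0\<close> by (simp add: trajectory_eq scalar_zero quat_sel_simps)
    then show False
      using arg_cong[OF fg(3), of q0] fg(2) assms(1) by (simp add: quat_scale_def quat.map_sel)
  qed
  define r where "r = shift_to_origin y"
  have "q0 r = 0"
    by (simp add: r_def shift_to_origin_def)
  have "quat_scale (f * [:q0 y:]) (trajectory (C * dq_const (translation r)) 1) = quat_scale g x"
    using fg(3) trajectory_translation[OF \<open>q0 y \<noteq> 0\<close>, of C]
    by (simp only: quat_scale_eq scalar_mult mult.assoc r_def)
  moreover have "f * [:q0 y:] \<noteq> 0"
    using fg(1) \<open>q0 y \<noteq> 0\<close> by simp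
  ultimately have "parameterised_by (trajectory (C * dq_const (translation r)) 1) x"
    using fg(2) unfolding parameterised_by_def by blast
  then have "origin_motion x (C * dq_const (translation r))"
    using C \<open>q0 r = 0\<close> by (simp add: origin_motion_def displacement_mult displacement_dq_const
        displacement_translation)
  then show thesis
    using that \<open>q0 r = 0\<close> by blast
qed

section \<open>Motions through a reduced curve\<close>

locale reduced_curve =
  fixes x :: "real poly quat"
  assumes q0_nz: "q0 x \<noteq> 0" and reduced: "reduced x"
begin

text \<open>The vector part of the curve. The complex roots of the polynomial \<open>G\<close> below are the
  parameter values at which the curve meets the absolute conic, so that its degree is twice the circularity.\<close>

definition v :: "real poly quat" where
  "v = Quat 0 (q1 x) (q2 x) (q3 x)"

definition G :: "real poly" where
  "G = gcd (q0 x) (qnorm v)"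

definition a :: "real poly" where
  "a = q0 x div G"

definition b :: "real poly" where
  "b = qnorm v div G"

lemma x_eq: "x = scalar (q0 x) + v"
  by (simp add: v_def quat_components)

lemma q0_eq: "q0 x = a * G"
  and qnorm_v: "qnorm v = b * G"
  by (simp_all add: a_def b_def G_def)

lemma a_nz: "a \<noteq> 0" and G_nz: "G \<noteq> 0"
  using q0_nz q0_eq by auto

lemma coprime_a_b: "coprime a b"
  unfolding a_def b_def G_def by (rule div_gcd_coprime) (use q0_nz in simp)

lemma circularity_eq: "circularity x = real (degree G) / 2"
  by (simp add: circularity_def G_def qnorm_def v_def)

lemma quat_degree_x: "quat_degree x = max (degree (q0 x)) (quat_degree v)"
  by (simp add: quat_degree_def v_def)

text \<open>A common divisor of \<open>g x\<^sub>0, \<dots>, g x\<^sub>3\<close> divides \<open>g\<close> times their constant gcd.\<close>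

lemma dvd_mult_components:
  assumes "scalar_dvd f (scalar g * x)"
  shows "f dvd g"
proof -
  define d where "d = gcd (q0 x) (gcd (q1 x) (gcd (q2 x) (q3 x)))"
  have step: "f dvd g * gcd p q" if "f dvd g * p" "f dvd g * q" for p q
  proof -
    have "f dvd gcd (g * p) (g * q)"
      using that by (rule gcd_greatest)
    then show ?thesis
      by (simp add: gcd_mult_left)
  qed
  have "f dvd g * d"
    using assms unfolding d_def
    by (intro step) (simp_all add: scalar_dvd_iff, simp_all add: quat_components)
  moreover have "degree d = 0" "d \<noteq> 0"
    using reduced q0_nz by (simp_all add: reduced_def d_def)
  then have "d dvd 1"
    by (simp add: is_unit_iff_degree)
  ultimately show ?thesis
    by (simp add: dvd_mult_unit_iff)
qed

lemma primitive_v: "primitive_at G v"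
  unfolding primitive_at_def
proof (intro allI impI)
  fix m
  assume "m dvd G" "scalar_dvd m v"
  then have "scalar_dvd m (scalar 1 * x)"
    by (simp add: scalar_dvd_iff scalar_one v_def q0_eq)
  then have "m dvd 1"
    by (rule dvd_mult_components)
  then show "degree m = 0"
    using dvd_imp_degree_le[of m 1] by simp
qed

text \<open>In \<open>f (|P|\<^sup>2 + 2 P Q\<^sup>*) = g x\<close> the polynomial \<open>f\<close> divides \<open>g\<close> because \<open>x\<close> is reduced; then
  \<open>h = g / f\<close>, and the two equations are the scalar and the vector part.\<close>

lemma origin_motion_iff:
  "origin_motion x C \<longleftrightarrow> (\<exists>h. h \<noteq> 0 \<and> qnorm (primal C) = h * q0 x
     \<and> scalar 2 * (primal C * qcnj (dual C)) = scalar h * v)"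
proof
  assume "origin_motion x C"
  then have C: "primal C \<noteq> 0" "q0 (primal C * qcnj (dual C)) = 0"
    and "parameterised_by (trajectory C 1) x"
    by (auto simp: origin_motion_def displacement_iff)
  then obtain f g where fg: "f \<noteq> 0" "g \<noteq> 0" "scalar f * trajectory C 1 = scalar g * x"
    by (auto simp: parameterised_by_def quat_scale_eq)
  then have "f dvd g"
    by (intro dvd_mult_components) (metis scalar_dvd_def)
  then obtain h where h: "g = f * h" ..
  then have "scalar f * trajectory C 1 = scalar f * (scalar h * x)"
    using fg(3) by (simp add: scalar_mult mult.assoc)
  then have T: "trajectory C 1 = scalar h * x"
    using fg(1) by (simp add: quat_mult_left_cancel scalar_eq_0_iff)
  have "q0 (scalar 2 * (primal C * qcnj (dual C))) = 2 * q0 (primal C * qcnj (dual C))"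
    by (simp add: times_quat_def scalar_def)
  then have norm: "qnorm (primal C) = h * q0 x"
    using arg_cong[OF T[unfolded trajectory_origin], of q0] C(2)
    by (simp add: plus_quat_def) (simp add: scalar_def times_quat_def)
  have "scalar (h * q0 x) + scalar 2 * (primal C * qcnj (dual C)) = scalar (h * q0 x) + scalar h * v"
    using T x_eq unfolding trajectory_origin norm by (metis distrib_left scalar_mult)
  then show "\<exists>h. h \<noteq> 0 \<and> qnorm (primal C) = h * q0 x
     \<and> scalar 2 * (primal C * qcnj (dual C)) = scalar h * v"
    using norm h fg(2) by auto
next
  assume "\<exists>h. h \<noteq> 0 \<and> qnorm (primal C) = h * q0 x
     \<and> scalar 2 * (primal C * qcnj (dual C)) = scalar h * v"
  then obtain h where h: "h \<noteq> 0" "qnorm (primal C) = h * q0 x"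
    "scalar 2 * (primal C * qcnj (dual C)) = scalar h * v"
    by blast
  have "trajectory C 1 = scalar h * x"
    unfolding trajectory_origin h(2,3) by (metis distrib_left scalar_mult x_eq)
  then have "quat_scale 1 (trajectory C 1) = quat_scale h x"
    by (simp add: quat_scale_eq scalar_one)
  then have "parameterised_by (trajectory C 1) x"
    using h(1) unfolding parameterised_by_def by (metis zero_neq_one)
  moreover have "primal C \<noteq> 0"
    using h q0_nz by (metis mult_eq_0_iff qnorm_eq_0_iff)
  moreover have "q0 (scalar 2 * (primal C * qcnj (dual C))) = 0"
    unfolding h(3) by (simp add: v_def quat_components)
  then have "q0 (primal C * qcnj (dual C)) = 0"
    by (simp add: times_quat_def scalar_def)
  ultimately show "origin_motion x C"
    by (simp add: origin_motion_def displacement_iff)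
qed

text \<open>Taking norms in \<open>2 P Q\<^sup>* = h v\<close> and cancelling \<open>h G\<close> leaves \<open>4 a |Q|\<^sup>2 = h b\<close>, whence \<open>a\<close> divides
  \<open>h\<close>.\<close>

lemma origin_motion_cofactor:
  assumes "origin_motion x C"
  obtains k where "k \<noteq> 0" "qnorm (primal C) = k * a * q0 x"
    "scalar 2 * (primal C * qcnj (dual C)) = scalar (k * a) * v" "4 * qnorm (dual C) = k * b"
proof -
  obtain h where h: "h \<noteq> 0" "qnorm (primal C) = h * q0 x"
    "scalar 2 * (primal C * qcnj (dual C)) = scalar h * v"
    using assms unfolding origin_motion_iff by blast
  have "(h * G) * (4 * (a * qnorm (dual C))) = (h * G) * (h * b)"
    using arg_cong[OF h(3), of qnorm]
    by (simp add: qnorm_mult qnorm_qcnj qnorm_scalar h(2) q0_eq qnorm_v power2_eq_square ac_simps)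
  then have hb: "a * (4 * qnorm (dual C)) = h * b"
    using h(1) G_nz by (simp add: ac_simps)
  then have "a dvd h * b"
    by (metis dvd_triv_left)
  then have "a dvd h"
    using coprime_a_b by (simp add: coprime_dvd_mult_left_iff)
  then obtain k where k: "h = a * k" ..
  then have "4 * qnorm (dual C) = k * b"
    using hb a_nz by simp
  then show thesis
    using that[of k] h k by (simp add: mult.commute)
qed

text \<open>With \<open>deg G = 2 c\<close> this is \<open>deg C = d - c + deg k / 2\<close>. The norms of \<open>P\<close> and \<open>Q\<close> give
  \<open>deg P = deg x\<^sub>0 - c + deg k / 2\<close> and \<open>deg Q = deg v - c + deg k / 2\<close>, the latter if \<open>v \<noteq> 0\<close>; for
  \<open>v = 0\<close> the dual part vanishes and \<open>P\<close> alone determines the degree.\<close>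

lemma origin_motion_degree:
  assumes "k \<noteq> 0" "qnorm (primal C) = k * a * q0 x" "4 * qnorm (dual C) = k * b"
  shows "2 * dq_degree C + degree G = 2 * quat_degree x + degree k"
proof -
  have q0_deg: "degree (q0 x) = degree a + degree G"
    unfolding q0_eq using a_nz G_nz by (rule degree_mult_eq)
  have "2 * quat_degree (primal C) = degree k + degree a + degree (q0 x)"
    unfolding degree_qnorm[symmetric] assms(2) using assms(1) a_nz q0_nz
    by (simp add: degree_mult_eq)
  then have P: "2 * quat_degree (primal C) + degree G = 2 * degree (q0 x) + degree k"
    using q0_deg by simp
  show ?thesis
  proof (cases "b = 0")
    case True
    then have "v = 0" "dual C = 0"
      using assms(3) qnorm_v by (simp_all flip: qnorm_eq_0_iff)
    moreover have "quat_degree 0 = 0"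
      by (simp add: quat_degree_def zero_quat_def)
    ultimately show ?thesis
      using P by (simp add: dq_degree_def quat_degree_x)
  next
    case False
    have "2 * quat_degree (dual C) = degree (4 * qnorm (dual C))"
      by (simp add: degree_qnorm numeral_poly)
    also have "\<dots> = degree k + degree b"
      unfolding assms(3) using assms(1) False by (rule degree_mult_eq)
    finally have "2 * quat_degree (dual C) + degree G = 2 * quat_degree v + degree k"
      using degree_mult_eq[OF False G_nz] by (simp add: qnorm_v flip: degree_qnorm)
    then show ?thesis
      using P unfolding dq_degree_def quat_degree_x by linarith
  qed
qed

text \<open>With \<open>v = D V\<close> and \<open>|D|\<^sup>2 = m G\<close>, the choice \<open>P = a D\<close>, \<open>2 Q\<^sup>* = m V\<close> has the cofactor
  \<open>k = m\<close>, a constant.\<close>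

lemma exists_minimal_origin_motion:
  obtains C where "origin_motion x C" "2 * dq_degree C + degree G = 2 * quat_degree x"
proof -
  obtain D V m where D: "v = D * V" "qnorm D = m * G" "degree m = 0" "m \<noteq> 0"
    using exists_left_factor[OF G_nz _ primitive_v] qnorm_v by auto
  define C where "C = Dual (scalar a * D) (qcnj (scalar (smult (1/2) m) * V))"
  have P: "qnorm (primal C) = (m * a) * q0 x"
    by (simp add: C_def qnorm_mult qnorm_scalar D(2) q0_eq power2_eq_square ac_simps)
  have two: "scalar 2 * (scalar (smult (1/2) m) * Z) = scalar m * Z" for Z
    by (simp add: numeral_poly flip: mult.assoc scalar_mult)
  have "scalar 2 * (primal C * qcnj (dual C)) = scalar a * (scalar 2 * (scalar (smult (1/2) m) * v))"
    by (simp add: C_def D(1) qcnj_qcnj mult.assoc scalar_left_commute[of D]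
        scalar_left_commute[of "scalar 2" a])
  then have "scalar 2 * (primal C * qcnj (dual C)) = scalar (m * a) * v"
    unfolding two by (simp add: scalar_mult mult.commute[of m a] mult.assoc)
  with P have "origin_motion x C"
    unfolding origin_motion_iff using D(4) a_nz by (metis mult_eq_0_iff)
  moreover obtain k where k: "k \<noteq> 0" "qnorm (primal C) = k * a * q0 x"
      "4 * qnorm (dual C) = k * b"
    using origin_motion_cofactor[OF \<open>origin_motion x C\<close>] by metis
  then have "k = m"
    using P a_nz q0_nz by simp
  then have "2 * dq_degree C + degree G = 2 * quat_degree x"
    using origin_motion_degree[OF k] D(3) by simp
  ultimately show thesis ..
qed

text \<open>As \<open>k\<close> is constant, right multiplication of \<open>2 P Q\<^sup>* = k a v\<close> by \<open>2 Q\<close> gives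
  \<open>b P = 2 a v Q\<close>. So \<open>a\<close> divides \<open>b P\<close>, and being coprime to \<open>b\<close> it divides \<open>P\<close>.\<close>

lemma minimal_origin_motion_factor:
  assumes "origin_motion x C" "2 * dq_degree C + degree G = 2 * quat_degree x"
  obtains A B k where "primal C = scalar a * A" "scalar 2 * qcnj (dual C) = scalar k * B"
    "v = A * B" "qnorm A = k * G" "degree k = 0" "A \<noteq> 0"
proof -
  define P Q where "P = primal C" and "Q = scalar 2 * qcnj (dual C)"
  obtain k where k: "k \<noteq> 0" "qnorm P = k * a * q0 x"
    "scalar 2 * (P * qcnj (dual C)) = scalar (k * a) * v" "4 * qnorm (dual C) = k * b"
    using origin_motion_cofactor[OF assms(1)] unfolding P_def by metis
  have "degree k = 0"
    using origin_motion_degree[OF k(1) k(2)[unfolded P_def] k(4)] assms(2) by simp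
  have PQ: "P * Q = scalar (k * a) * v" "qnorm Q = k * b"
    using k(3,4) by (simp_all add: Q_def scalar_left_commute qnorm_mult qnorm_scalar qnorm_qcnj)
  have "scalar k * (scalar b * P) = P * (Q * qcnj Q)"
    unfolding mult_qcnj PQ(2) scalar_commute by (simp add: scalar_mult mult.assoc)
  also have "\<dots> = scalar k * (scalar a * (v * qcnj Q))"
    by (simp add: PQ(1) scalar_mult mult.assoc[symmetric])
  finally have "scalar_dvd a (scalar b * P)"
    using k(1) by (auto simp: scalar_dvd_def quat_mult_left_cancel scalar_eq_0_iff)
  then have "scalar_dvd a P"
    using coprime_a_b unfolding scalar_dvd_iff
    by (simp add: times_quat_def scalar_def coprime_dvd_mult_right_iff)
  then obtain A where A: "P = scalar a * A"
    unfolding scalar_dvd_def ..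
  have "(a * a) * qnorm A = (a * a) * (k * G)"
    using k(2) by (simp add: A qnorm_mult qnorm_scalar q0_eq power2_eq_square ac_simps)
  then have norm_A: "qnorm A = k * G"
    using a_nz by simp
  have "scalar a * (A * Q) = scalar a * (scalar k * v)"
    using PQ(1) by (simp add: A mult.commute[of k a] scalar_mult mult.assoc)
  then have AQ: "A * Q = scalar k * v"
    using a_nz by (simp add: quat_mult_left_cancel scalar_eq_0_iff)
  have "k dvd 1"
    using k(1) \<open>degree k = 0\<close> by (simp add: is_unit_iff_degree)
  then obtain j where "1 = k * j" ..
  then have j: "scalar k * (scalar j * Z) = Z" for Z
    by (metis mult.assoc mult_1 scalar_mult scalar_one)
  have "scalar k * v = scalar k * (A * (scalar j * Q))"
    by (simp add: scalar_left_commute[of A] j AQ)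
  then have "v = A * (scalar j * Q)"
    using k(1) by (simp add: quat_mult_left_cancel scalar_eq_0_iff)
  moreover have "A \<noteq> 0"
    using norm_A k(1) G_nz by (metis mult_eq_0_iff qnorm_eq_0_iff)
  ultimately show thesis
    using that[of A k "scalar j * Q"] A norm_A \<open>degree k = 0\<close> j by (simp add: P_def Q_def)
qed

text \<open>Uniqueness of the left factor gives \<open>P' = P u\<close>. Then \<open>k' = k |u|\<^sup>2\<close> and \<open>B = u B'\<close>, so
  \<open>2 Q'\<^sup>* = k' B' = k u\<^sup>* u B' = 2 u\<^sup>* Q\<^sup>*\<close>, that is \<open>Q' = Q u\<close>.\<close>

lemma minimal_origin_motion_unique:
  assumes "origin_motion x C" "2 * dq_degree C + degree G = 2 * quat_degree x"
    and "origin_motion x C'" "2 * dq_degree C' + degree G = 2 * quat_degree x"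
  obtains u where "u \<noteq> 0" "C' = C * dq_const (Dual u 0)"
proof -
  obtain A B k where A: "primal C = scalar a * A" "scalar 2 * qcnj (dual C) = scalar k * B"
    "v = A * B" "qnorm A = k * G" "degree k = 0" "A \<noteq> 0"
    using minimal_origin_motion_factor[OF assms(1,2)] .
  obtain A' B' k' where A': "primal C' = scalar a * A'" "scalar 2 * qcnj (dual C') = scalar k' * B'"
    "v = A' * B'" "qnorm A' = k' * G" "degree k' = 0" "A' \<noteq> 0"
    using minimal_origin_motion_factor[OF assms(3,4)] .
  obtain u where u: "A' = A * quat_const u"
    using left_factor_unique[OF primitive_v A(3-6) A'(3-6)] .
  define U where "U = quat_const u"
  have "k' * G = k * qnorm U * G"
    using arg_cong[OF u, of qnorm] A(4) A'(4) by (simp add: qnorm_mult U_def ac_simps)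
  then have k': "k' = k * qnorm U"
    using G_nz by simp
  have "A * B = A * (U * B')"
    using A(3) A'(3) u by (simp add: U_def mult.assoc)
  then have B: "B = U * B'"
    using A(6) by (simp add: quat_mult_left_cancel)
  have "scalar 2 * qcnj (dual C') = scalar k * (qcnj U * B)"
    unfolding A'(2) k' B by (simp add: scalar_mult mult.assoc flip: qcnj_mult_self)
  also have "\<dots> = qcnj U * (scalar 2 * qcnj (dual C))"
    by (simp add: A(2) scalar_left_commute)
  also have "\<dots> = scalar 2 * qcnj (dual C * U)"
    by (simp add: qcnj_mult scalar_left_commute)
  finally have "qcnj (dual C') = qcnj (dual C * U)"
    by (simp add: quat_mult_left_cancel scalar_eq_0_iff)
  then have "dual C' = dual C * U"
    by (metis qcnj_qcnj)
  moreover have "primal C' = primal C * U"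
    by (simp add: A(1) A'(1) u U_def mult.assoc)
  moreover have "quat_const 0 = 0"
    by (simp add: quat_const_eq_0_iff)
  ultimately have "C' = C * dq_const (Dual u 0)"
    by (intro dualnum.expand) (simp add: times_dualnum_def dq_const_sel U_def)
  moreover have "u \<noteq> 0"
    using A'(6) u by (auto simp: quat_mult_eq_0_iff quat_const_eq_0_iff)
  ultimately show thesis
    using that by blast
qed

lemma motion_degree_ge:
  assumes "motion_with_trajectory x C"
  shows "2 * quat_degree x \<le> 2 * dq_degree C + degree G"
proof -
  obtain r where "origin_motion x (C * dq_const (translation r))"
    using translate_to_origin[OF q0_nz assms] .
  then obtain k where "k \<noteq> 0"
      "qnorm (primal (C * dq_const (translation r))) = k * a * q0 x"
      "4 * qnorm (dual (C * dq_const (translation r))) = k * b"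
    by (rule origin_motion_cofactor)
  then show ?thesis
    using origin_motion_degree by (metis dq_degree_translation le_add1)
qed

lemma is_arg_min_iff:
  "is_arg_min dq_degree (motion_with_trajectory x) C \<longleftrightarrow>
     motion_with_trajectory x C \<and> 2 * dq_degree C + degree G = 2 * quat_degree x"
proof -
  obtain C0 where C0: "motion_with_trajectory x C0" "2 * dq_degree C0 + degree G = 2 * quat_degree x"
    using exists_minimal_origin_motion origin_motion_imp_motion by metis
  show ?thesis
  proof
    assume "is_arg_min dq_degree (motion_with_trajectory x) C"
    then have "motion_with_trajectory x C" "dq_degree C \<le> dq_degree C0"
      using C0(1) by (auto simp: is_arg_min_def not_less)
    then show "motion_with_trajectory x C \<and> 2 * dq_degree C + degree G = 2 * quat_degree x"
      using motion_degree_ge[of C] C0(2) by linarith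
  next
    assume C: "motion_with_trajectory x C \<and> 2 * dq_degree C + degree G = 2 * quat_degree x"
    have "\<not> dq_degree D < dq_degree C" if "motion_with_trajectory x D" for D
      using motion_degree_ge[OF that] C by linarith
    then show "is_arg_min dq_degree (motion_with_trajectory x) C"
      using C by (auto simp: is_arg_min_def)
  qed
qed

lemma minimal_motion_unique:
  assumes "is_arg_min dq_degree (motion_with_trajectory x) C"
    "is_arg_min dq_degree (motion_with_trajectory x) C'"
  obtains h where "displacement h" "C' = C * dq_const h"
proof -
  have C: "motion_with_trajectory x C" "motion_with_trajectory x C'"
    "2 * dq_degree C + degree G = 2 * quat_degree x"
    "2 * dq_degree C' + degree G = 2 * quat_degree x"
    using assms by (simp_all add: is_arg_min_iff)
  obtain r where r: "q0 r = 0" "origin_motion x (C * dq_const (translation r))"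
    using translate_to_origin[OF q0_nz C(1)] .
  obtain r' where r': "q0 r' = 0" "origin_motion x (C' * dq_const (translation r'))"
    using translate_to_origin[OF q0_nz C(2)] .
  obtain u where u: "u \<noteq> 0"
    "C' * dq_const (translation r') = C * dq_const (translation r) * dq_const (Dual u 0)"
    using minimal_origin_motion_unique[OF r(2) _ r'(2)] C(3,4)
    unfolding dq_degree_translation by metis
  define h where "h = translation r * Dual u 0 * translation (- r')"
  have "C' = C' * dq_const (translation r') * dq_const (translation (- r'))"
    by (simp only: undo_translation)
  also have "\<dots> = C * dq_const h"
    by (simp only: u(2) mult_dq_const_assoc h_def)
  finally have "C' = C * dq_const h" .
  moreover have "displacement (Dual u 0)"
    using u(1) by (simp add: displacement_def) (simp add: quat_components)
  then have "displacement h"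
    unfolding h_def using r(1) r'(1)
    by (intro displacement_mult displacement_translation) (simp_all add: uminus_quat_def)
  ultimately show thesis
    using that by blast
qed

end

lemma dq_smult_one: "dq_smult 1 C = C"
  by (cases C; cases "primal C"; cases "dual C")
    (simp add: dq_smult_def quat_eq_iff quat.map_sel)

theorem corollary2:
  fixes x :: "real poly quat"
  assumes "q0 x \<noteq> 0"
    and "reduced x"
  shows "(\<exists>C. is_arg_min dq_degree (motion_with_trajectory x) C)
    \<and> (\<forall>C. is_arg_min dq_degree (motion_with_trajectory x) C
          \<longrightarrow> real (dq_degree C) = real (quat_degree x) - circularity x)
    \<and> (\<forall>C C'. is_arg_min dq_degree (motion_with_trajectory x) C
          \<and> is_arg_min dq_degree (motion_with_trajectory x) C'
          \<longrightarrow> (\<exists>(l::real) (h::dual_quat). l \<noteq> 0 \<and> displacement h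
                \<and> C' = dq_smult l (C * dq_const h)))"
proof -
  interpret reduced_curve x
    using assms by unfold_locales
  have "\<exists>C. is_arg_min dq_degree (motion_with_trajectory x) C"
    using exists_minimal_origin_motion origin_motion_imp_motion unfolding is_arg_min_iff by metis
  moreover have "real (dq_degree C) = real (quat_degree x) - circularity x"
    if "is_arg_min dq_degree (motion_with_trajectory x) C" for C
  proof -
    have "2 * dq_degree C + degree G = 2 * quat_degree x"
      using that by (simp add: is_arg_min_iff)
    then show ?thesis
      unfolding circularity_eq by linarith
  qed
  moreover have "\<exists>(l::real) h. l \<noteq> 0 \<and> displacement h \<and> C' = dq_smult l (C * dq_const h)"
    if "is_arg_min dq_degree (motion_with_trajectory x) C"
      "is_arg_min dq_degree (motion_with_trajectory x) C'" for C C'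
    using minimal_motion_unique[OF that] by (metis dq_smult_one zero_neq_one)
  ultimately show ?thesis
    by blast
qed

end
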